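(* For every integer $n\ge 1$ there exists an explicit bijection between the set of $3$-compositions of $n$ and the set of pairs of compositions of $n$.
   Context: A composition of a positive integer $n$ is a finite sequence of positive integers (called parts) with sum $n$. A pair of compositions of $n$ is an ordered pair $((a_1,\dots,a_k),(b_1,\dots,b_\ell))$ of compositions of $n$ (with $k$ and $\ell$ not necessarily equal). A $k$-composition of $n$ (in the sense of Andrews) is a composition of $n$ in which each part is assigned one of $k$ colors $1,\dots,k$, such that the last part has color $1$; here $k=3$. *)

theory Defs
  imports Main
begin

definition compositions :: "nat \<Rightarrow> nat list set" where
  "compositions n = {xs. (\<forall>x\<in>set xs. 0 < x) \<and> sum_list xs = n}"

text \<open>A coloured part is a pair (part, colour).\<close>

definition k_compositions :: "nat \<Rightarrow> nat \<Rightarrow> (nat \<times> nat) list set" where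
  "k_compositions k n = {cs. map fst cs \<in> compositions n \<and> (\<forall>c\<in>set (map snd cs). c \<in> {1..k})
     \<and> cs \<noteq> [] \<and> snd (last cs) = 1}"

text \<open>
  Forget the colours, after adding each part of colour \<open>c\<close> to the part on its right.
\<close>

fun merge_colour :: "nat \<Rightarrow> (nat \<times> nat) list \<Rightarrow> nat list" where
  "merge_colour c [] = []"
| "merge_colour c ((m, d) # cs) =
     (if d = c
      then (case merge_colour c cs of [] \<Rightarrow> [m] | b # bs \<Rightarrow> (m + b) # bs)
      else m # merge_colour c cs)"

text \<open>
  The explicit bijection. View a composition of \<open>n\<close> as a set of cuts of a strip of length \<open>n\<close>,
  each part ending in a cut, so that the end of the strip is always cut. The right end of a
  part of a 3-composition is cut in both components of the pair if the part has colour 1,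
  only in the first if it has colour 2, and only in the second if it has colour 3. The colour
  of the last part is 1 because the end of the strip is cut in both components. For example,
  the coloured parts (2, 3), (1, 2), (4, 1) of a 3-composition of 7 give the pair (3, 4), (2, 5).
\<close>

definition three_composition_to_pair :: "(nat \<times> nat) list \<Rightarrow> nat list \<times> nat list" where
  "three_composition_to_pair cs = (merge_colour 3 cs, merge_colour 2 cs)"

end

theory Submission
  imports Defs
begin

text \<open>
  The inverse map scans the strip from the left: the next coloured part ends at the first cut
  that occurs in either composition, and its colour records which of the two are cut there.
\<close>

fun pair_to_three_composition :: "nat list \<Rightarrow> nat list \<Rightarrow> (nat \<times> nat) list" where
  "pair_to_three_composition (a # as) (b # bs) =
     (if a = b then (a, 1) # pair_to_three_composition as bs
      else if a < b then (a, 2) # pair_to_three_composition as ((b - a) # bs)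
      else (b, 3) # pair_to_three_composition ((a - b) # as) bs)"
| "pair_to_three_composition _ _ = []"

lemma merge_colour_eq_Nil_iff [simp]: "merge_colour c cs = [] \<longleftrightarrow> cs = []"
  by (induction c cs rule: merge_colour.induct) (auto split: list.split)

text \<open>Merging only deletes cuts inside the strip, so the length is kept. A final part of
  colour \<open>c\<close> stays as \<open>[m]\<close>, so no condition on the last colour is needed
  here.\<close>

lemma merge_colour_in_compositions:
  "map fst cs \<in> compositions n \<Longrightarrow> merge_colour c cs \<in> compositions n"
proof (induction c cs arbitrary: n rule: merge_colour.induct)
  case (2 c m d cs)
  then have "0 < m" "merge_colour c cs \<in> compositions (n - m)" "m \<le> n"
    by (cases "d = c"; auto simp: compositions_def)+
  then show ?case by (auto simp: compositions_def split: list.split)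
qed simp

text \<open>Makes \<open>m < m + b\<close> strict whenever a part \<open>m\<close> is merged into
  \<open>b\<close>, so that the inverse map can tell colours 2 and 3 from colour 1.\<close>

lemma merge_colour_pos:
  "\<forall>m\<in>set (map fst cs). 0 < m \<Longrightarrow> merge_colour c cs = b # bs \<Longrightarrow> 0 < b"
  using merge_colour_in_compositions[of cs "sum_list (map fst cs)" c]
  by (simp add: compositions_def)

text \<open>A first part \<open>m\<close> of colour 1 starts both components; with colour 2 or 3 it
  starts one, while the other starts with \<open>m + b\<close>. The scan thus picks the right
  colour, and its subtraction gives back \<open>b\<close>. The condition on the last colour is
  guarded by \<open>cs \<noteq> []\<close> so that the induction can reach the empty list.\<close>

lemma pair_to_three_composition_merge_colour:
  assumes "\<forall>m\<in>set (map fst cs). 0 < m" "\<forall>d\<in>set (map snd cs). d \<in> {1..3}"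
    and "cs \<noteq> [] \<longrightarrow> snd (last cs) = 1"
  shows "pair_to_three_composition (merge_colour 3 cs) (merge_colour 2 cs) = cs"
  using assms
proof (induction cs)
  case (Cons p cs)
  obtain m d where p: "p = (m, d)" by (cases p)
  have IH: "pair_to_three_composition (merge_colour 3 cs) (merge_colour 2 cs) = cs"
    using Cons.prems by (cases "cs = []") (simp, intro Cons.IH, simp_all)
  have pos: "\<And>c b bs. merge_colour c cs = b # bs \<Longrightarrow> 0 < b"
    using Cons.prems(1) by (intro merge_colour_pos[of cs]) simp_all
  have "d \<in> {1..3}" "cs = [] \<longrightarrow> d = 1"
    using Cons.prems(2,3) p by auto
  \<comment> \<open>A part of colour 2 or 3 is never last, so there is a part on its right to merge
    into.\<close>
  then consider "d = 1" | "d = 2" "cs \<noteq> []" | "d = 3" "cs \<noteq> []"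
    by (cases "cs = []") (simp, simp, force)
  then show ?case
  proof cases
    case 1
    then show ?thesis using IH p by simp
  next
    case 2
    then obtain b bs where "merge_colour 2 cs = b # bs"
      by (metis list.exhaust merge_colour_eq_Nil_iff)
    then show ?thesis using IH p 2 pos[of 2 b bs] by simp
  next
    case 3
    then obtain b bs where "merge_colour 3 cs = b # bs"
      by (metis list.exhaust merge_colour_eq_Nil_iff)
    then show ?thesis using IH p 3 pos[of 3 b bs] by simp
  qed
qed simp

text \<open>Every recursive call removes the same length from both lists, so the sums stay equal and
  the lists run out together. The claims are proved jointly because the one on the last colour
  relies on \<open>cs = [] \<longleftrightarrow> as = []\<close> for the recursive call.\<close>

lemma pair_to_three_composition_correct:
  assumes "\<forall>a\<in>set as. 0 < a" "\<forall>b\<in>set bs. 0 < b" "sum_list as = sum_list bs"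
  defines "cs \<equiv> pair_to_three_composition as bs"
  shows "map fst cs \<in> compositions (sum_list as) \<and> (\<forall>d\<in>set (map snd cs). d \<in> {1..3}) \<and>
    (cs \<noteq> [] \<longrightarrow> snd (last cs) = 1) \<and> (cs = [] \<longleftrightarrow> as = []) \<and>
    merge_colour 3 cs = as \<and> merge_colour 2 cs = bs"
  using assms(1-3) unfolding cs_def
proof (induction as bs rule: pair_to_three_composition.induct)
  case (1 a as b bs)
  consider "a = b" | "a < b" | "b < a" by linarith
  then show ?case
  proof cases
    case 1
    with "1.IH"(1) "1.prems" show ?thesis by (auto simp: compositions_def)
  next
    case 2
    \<comment> \<open>Equal sums with \<open>a < b\<close> leave a positive length in
      \<open>as\<close>. Hence the recursive result is nonempty, and the last part is one of its
      own, not the new part of colour 2.\<close>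
    with "1.prems" have "as \<noteq> []" by auto
    with 2 "1.IH"(2) "1.prems" show ?thesis by (auto simp: compositions_def)
  next
    case 3
    with "1.prems" have "bs \<noteq> []" by auto
    with 3 "1.IH"(3) "1.prems" show ?thesis by (auto simp: compositions_def)
  qed
next
  case ("2_1" bs)
  \<comment> \<open>With one list empty both sums are 0, and positivity of the parts makes the other
    list empty too.\<close>
  then show ?case by (cases bs) (auto simp: compositions_def)
next
  case ("2_2" as)
  then show ?case by (cases as) (auto simp: compositions_def)
qed

theorem proposition2p3:
  fixes n :: nat
  assumes "n \<ge> 1"
  shows "bij_betw three_composition_to_pair (k_compositions 3 n) (compositions n \<times> compositions n)"
proof (rule bij_betw_byWitness[where f' = "\<lambda>(as, bs). pair_to_three_composition as bs"])
  show "\<forall>cs\<in>k_compositions 3 n.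
      (\<lambda>(as, bs). pair_to_three_composition as bs) (three_composition_to_pair cs) = cs"
    using pair_to_three_composition_merge_colour
    by (auto simp: k_compositions_def three_composition_to_pair_def compositions_def)
  show "\<forall>p\<in>compositions n \<times> compositions n.
      three_composition_to_pair ((\<lambda>(as, bs). pair_to_three_composition as bs) p) = p"
    using pair_to_three_composition_correct
    by (auto simp: three_composition_to_pair_def compositions_def)
  show "three_composition_to_pair ` k_compositions 3 n \<subseteq> compositions n \<times> compositions n"
    using merge_colour_in_compositions
    by (auto simp: k_compositions_def three_composition_to_pair_def)
  show "(\<lambda>(as, bs). pair_to_three_composition as bs) ` (compositions n \<times> compositions n)
      \<subseteq> k_compositions 3 n"
  proof clarify
    fix as bs assume *: "as \<in> compositions n" "bs \<in> compositions n"
    \<comment> \<open>Here \<open>n \<ge> 1\<close> enters: a 3-composition has to be nonempty,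
      while \<open>compositions 0\<close> contains the empty list.\<close>
    then have "as \<noteq> []" using assms by (auto simp: compositions_def)
    with * pair_to_three_composition_correct[of as bs]
    show "pair_to_three_composition as bs \<in> k_compositions 3 n"
      unfolding k_compositions_def by (simp add: compositions_def)
  qed
qed

end
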